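(* In a security game, the set of the defender's minimax strategies is equal to the set of the defender's Nash equilibrium strategies, i.e., $\Omega_M=\Omega_{NE}$.
   Context: A security game is a two-player game between a defender and an attacker, given by: a finite nonempty set of targets $T=\{t_1,\dots,t_n\}$; defender resources $r_1,\dots,r_K$; for each resource $r_i$ a nonempty set $S_i$ of schedules that $r_i$ can cover, each schedule being a subset of $T$; and for each target $t$ real payoffs $U_d^c(t),U_d^u(t)$ (defender, $t$ attacked while covered/uncovered) and $U_a^c(t),U_a^u(t)$ (attacker), such that $\Delta U_d(t):=U_d^c(t)-U_d^u(t)>0$ and $\Delta U_a(t):=U_a^u(t)-U_a^c(t)>0$. A defender pure strategy is an assignment $(s_1,\dots,s_K)\in\prod_{i=1}^K S_i$, represented by its coverage vector $\mathbf{d}\in\{0,1\}^n$ with $d_j=1$ iff $t_j\in\bigcup_i s_i$. Let $\mathcal{D}\subseteq\{0,1\}^n$ be the set of coverage vectors arising in this way. A defender (mixed) strategy $\mathbf{C}=(C_{\mathbf{d}})_{\mathbf{d}\in\mathcal{D}}$ is a probability distribution on $\mathcal{D}$; its vector of marginal coverage probabilities is $\mathbf{c}=\varphi(\mathbf{C})$, $c_i=\sum_{\mathbf{d}\in\mathcal{D}} d_iC_{\mathbf{d}}$. An attacker (mixed) strategy $\mathbf{a}=(a_i)$ is a probability distribution on $T$. Utilities are $$U_d(\mathbf{C},\mathbf{a})=\sum_{i=1}^n a_i\big(c_iU_d^c(t_i)+(1-c_i)U_d^u(t_i)\big),\qquad U_a(\mathbf{C},\mathbf{a})=\sum_{i=1}^n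 a_i\big(c_iU_a^c(t_i)+(1-c_i)U_a^u(t_i)\big),$$ and $U_a(\mathbf{C},t_i)$ denotes the attacker's utility of attacking $t_i$ with probability 1. Nash equilibrium (NE): $\langle\mathbf{C},\mathbf{a}\rangle$ with $U_d(\mathbf{C},\mathbf{a})\ge U_d(\mathbf{C}',\mathbf{a})$ for all $\mathbf{C}'$ and $U_a(\mathbf{C},\mathbf{a})\ge U_a(\mathbf{C},\mathbf{a}')$ for all $\mathbf{a}'$. $\Omega_{NE}$ is the set of defender strategies that are played in some NE. The attacker's best-response utility is $E(\mathbf{C})=\max_{1\le i\le n}U_a(\mathbf{C},t_i)$, $E^*=\min_{\mathbf{C}}E(\mathbf{C})$, and $\Omega_M=\{\mathbf{C}: E(\mathbf{C})=E^*\}$ is the set of defender minimax strategies. *)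

theory Defs
  imports "HOL-Analysis.Analysis" "HOL-Probability.Probability_Mass_Function"
begin

text \<open>The set of targets is the finite (hence also nonempty) type \<open>'t\<close>; the resources are the
  numbers \<open>i < num_resources G\<close>, and \<open>schedules G i\<close> is relevant only for those \<open>i\<close>.  The payoff
  fields are indexed by the player (\<open>d\<close>efender, \<open>a\<close>ttacker) and the status of the attacked target
  (\<open>c\<close>overed, \<open>u\<close>ncovered).\<close>

record 't security_game =
  num_resources :: nat
  schedules :: "nat \<Rightarrow> 't set set"
  payoff_dc :: "'t \<Rightarrow> real"
  payoff_du :: "'t \<Rightarrow> real"
  payoff_ac :: "'t \<Rightarrow> real"
  payoff_au :: "'t \<Rightarrow> real"

definition security_game :: "'t::finite security_game \<Rightarrow> bool" where
  "security_game G \<longleftrightarrow>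
     (\<forall>i < num_resources G. schedules G i \<noteq> {}) \<and>
     (\<forall>t. payoff_dc G t - payoff_du G t > 0) \<and>
     (\<forall>t. payoff_au G t - payoff_ac G t > 0)"

definition coverage_vector :: "'t::finite security_game \<Rightarrow> (nat \<Rightarrow> 't set) \<Rightarrow> real ^ 't" where
  "coverage_vector G s = (\<chi> t. if t \<in> (\<Union>i<num_resources G. s i) then 1 else 0)"

definition coverage_vectors :: "'t::finite security_game \<Rightarrow> (real ^ 't) set" where
  "coverage_vectors G = coverage_vector G ` (\<Pi>\<^sub>E i\<in>{..<num_resources G}. schedules G i)"

text \<open>Attacker mixed strategies are arbitrary elements of \<open>'t pmf\<close>.\<close>

definition defender_strategies :: "'t::finite security_game \<Rightarrow> (real ^ 't) pmf set" where
  "defender_strategies G = {C. set_pmf C \<subseteq> coverage_vectors G}"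

definition marginals :: "'t::finite security_game \<Rightarrow> (real ^ 't) pmf \<Rightarrow> real ^ 't" where
  "marginals G C = (\<chi> t. \<Sum>d\<in>coverage_vectors G. d $ t * pmf C d)"

definition defender_utility ::
    "'t::finite security_game \<Rightarrow> (real ^ 't) pmf \<Rightarrow> 't pmf \<Rightarrow> real" where
  "defender_utility G C a =
     (\<Sum>t\<in>UNIV. pmf a t * (marginals G C $ t * payoff_dc G t
                         + (1 - marginals G C $ t) * payoff_du G t))"

definition attacker_utility ::
    "'t::finite security_game \<Rightarrow> (real ^ 't) pmf \<Rightarrow> 't pmf \<Rightarrow> real" where
  "attacker_utility G C a =
     (\<Sum>t\<in>UNIV. pmf a t * (marginals G C $ t * payoff_ac G t
                         + (1 - marginals G C $ t) * payoff_au G t))"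

definition nash_equilibrium ::
    "'t::finite security_game \<Rightarrow> (real ^ 't) pmf \<Rightarrow> 't pmf \<Rightarrow> bool" where
  "nash_equilibrium G C a \<longleftrightarrow>
     C \<in> defender_strategies G \<and>
     (\<forall>C' \<in> defender_strategies G. defender_utility G C a \<ge> defender_utility G C' a) \<and>
     (\<forall>a'. attacker_utility G C a \<ge> attacker_utility G C a')"

definition NE_strategies :: "'t::finite security_game \<Rightarrow> (real ^ 't) pmf set" where
  "NE_strategies G = {C. \<exists>a. nash_equilibrium G C a}"

definition best_response_utility :: "'t::finite security_game \<Rightarrow> (real ^ 't) pmf \<Rightarrow> real" where
  "best_response_utility G C = (MAX t\<in>UNIV. attacker_utility G C (return_pmf t))"

text \<open>The minimum exists, see \<open>min_best_response_utility_attained\<close> below.\<close>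

definition min_best_response_utility :: "'t::finite security_game \<Rightarrow> real" where
  "min_best_response_utility G =
     (LEAST v. v \<in> best_response_utility G ` defender_strategies G)"

definition minimax_strategies :: "'t::finite security_game \<Rightarrow> (real ^ 't) pmf set" where
  "minimax_strategies G =
     {C \<in> defender_strategies G. best_response_utility G C = min_best_response_utility G}"

lemma finite_coverage_vectors: "finite (coverage_vectors G)"
proof -
  have "coverage_vectors G \<subseteq> range (\<lambda>A. \<chi> t. if t \<in> A then 1 else 0)"
    unfolding coverage_vectors_def coverage_vector_def by blast
  then show ?thesis
    by (rule finite_subset) simp
qed

lemma coverage_vectors_nonempty:
  assumes "security_game G"
  shows "coverage_vectors G \<noteq> {}"
  using assms by (auto simp: security_game_def coverage_vectors_def PiE_eq_empty_iff)

lemma attacker_utility_return_pmf: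
  "attacker_utility G C (return_pmf t) =
     marginals G C $ t * payoff_ac G t + (1 - marginals G C $ t) * payoff_au G t"
  by (simp add: attacker_utility_def pmf_return indicator_def if_distrib [of "\<lambda>x. x * _"] cong: if_cong)

lemma marginals_image: "marginals G ` defender_strategies G = convex hull (coverage_vectors G)"
proof (intro equalityI subsetI)
  fix x assume "x \<in> marginals G ` defender_strategies G"
  then obtain C where C: "set_pmf C \<subseteq> coverage_vectors G" "x = marginals G C"
    by (auto simp: defender_strategies_def)
  have "sum (pmf C) (coverage_vectors G) = 1"
    by (rule sum_pmf_eq_1) (use C finite_coverage_vectors in auto)
  moreover have "(\<Sum>d\<in>coverage_vectors G. pmf C d *\<^sub>R d) = x"
    by (simp add: C marginals_def vec_eq_iff mult.commute)
  ultimately show "x \<in> convex hull (coverage_vectors G)"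
    by (auto simp: convex_hull_finite [OF finite_coverage_vectors] intro!: exI [of _ "pmf C"])
next
  fix x assume "x \<in> convex hull (coverage_vectors G)"
  then obtain u where u: "\<And>d. d \<in> coverage_vectors G \<Longrightarrow> 0 \<le> u d"
      "sum u (coverage_vectors G) = 1" "(\<Sum>d\<in>coverage_vectors G. u d *\<^sub>R d) = x"
    by (auto simp: convex_hull_finite [OF finite_coverage_vectors])
  define w where "w = (\<lambda>d. if d \<in> coverage_vectors G then u d else 0)"
  define C where "C = embed_pmf w"
  have w0: "w d \<ge> 0" for d
    by (simp add: w_def u)
  have "(\<integral>\<^sup>+d. ennreal (w d) \<partial>count_space UNIV) = (\<Sum>d\<in>coverage_vectors G. ennreal (w d))"
    by (rule nn_integral_count_space'[OF finite_coverage_vectors]) (auto simp: w_def)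
  also have "\<dots> = ennreal (sum w (coverage_vectors G))"
    by (rule sum_ennreal) (rule w0)
  also have "sum w (coverage_vectors G) = 1"
    using u(2) by (simp add: w_def)
  finally have pC: "pmf C d = w d" for d
    unfolding C_def by (intro pmf_embed_pmf w0) simp
  have "C \<in> defender_strategies G"
    by (auto simp: defender_strategies_def set_pmf_eq pC w_def split: if_splits)
  moreover have "marginals G C = x"
    by (simp add: u(3) [symmetric] marginals_def vec_eq_iff pC w_def mult.commute)
  ultimately show "x \<in> marginals G ` defender_strategies G"
    by blast
qed

lemma continuous_on_Max_finite:
  fixes f :: "'i \<Rightarrow> 'a::topological_space \<Rightarrow> real"
  assumes "finite A" "A \<noteq> {}" "\<And>i. i \<in> A \<Longrightarrow> continuous_on S (f i)"
  shows "continuous_on S (\<lambda>x. MAX i\<in>A. f i x)"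
  using assms
proof (induction A rule: finite_ne_induct)
  case (insert i A)
  then have "continuous_on S (\<lambda>x. max (f i x) (MAX i\<in>A. f i x))"
    by (intro continuous_on_max) auto
  then show ?case
    using insert by simp
qed simp

lemma min_best_response_utility_attained:
  assumes "security_game G"
  shows "\<exists>C \<in> defender_strategies G. \<forall>C' \<in> defender_strategies G.
           best_response_utility G C \<le> best_response_utility G C'"
proof -
  define e where "e = (\<lambda>x::real ^ 'a. MAX t\<in>UNIV. x $ t * payoff_ac G t + (1 - x $ t) * payoff_au G t)"
  have "continuous_on UNIV e"
    unfolding e_def by (intro continuous_on_Max_finite continuous_intros) auto
  then have cont: "continuous_on (convex hull coverage_vectors G) e"
    by (rule continuous_on_subset) simp
  have "compact (convex hull (coverage_vectors G))"
    by (rule finite_imp_compact_convex_hull [OF finite_coverage_vectors])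
  moreover have "convex hull (coverage_vectors G) \<noteq> {}"
    using coverage_vectors_nonempty [OF assms] by simp
  ultimately obtain x where "x \<in> convex hull (coverage_vectors G)"
      "\<forall>y \<in> convex hull (coverage_vectors G). e x \<le> e y"
    using continuous_attains_inf cont by blast
  moreover have "best_response_utility G C = e (marginals G C)" for C
    by (simp add: e_def best_response_utility_def attacker_utility_return_pmf)
  ultimately show ?thesis
    unfolding marginals_image [symmetric] by auto
qed

end

(* Both kinds of strategy are characterised by nonnegative weights w on the targets that are
   concentrated on the attacker's best responses and for which the marginal vector of C maximises
   the sum of w t * v t * c t over all feasible marginals.  For Nash equilibria, w is the attacker's
   strategy and v the defender's gain from coverage; for minimax strategies, w is an optimal
   attacker strategy of the zero-sum game in which the defender minimises the attacker's utility
   (it exists by a separating hyperplane argument), and v is the attacker's loss from coverage.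
   Since both gains are positive, rescaling w exchanges one v for the other. *)

theory Submission
  imports Defs
begin

section \<open>Weights that certify optimality\<close>

definition defender_gain :: "'t::finite security_game \<Rightarrow> 't \<Rightarrow> real" where
  "defender_gain G t = payoff_dc G t - payoff_du G t"

definition attacker_loss :: "'t::finite security_game \<Rightarrow> 't \<Rightarrow> real" where
  "attacker_loss G t = payoff_au G t - payoff_ac G t"

abbreviation target_utility :: "'t::finite security_game \<Rightarrow> (real ^ 't) pmf \<Rightarrow> 't \<Rightarrow> real" where
  "target_utility G C t \<equiv> attacker_utility G C (return_pmf t)"

text \<open>Complementary slackness, together with the vector of products \<open>w t * v t\<close>
  being normal to the polytope of feasible marginals at the marginals of \<open>C\<close>. The sum
  of the weights need only be positive, not 1, so that rescaling target by target stays within the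
  notion.\<close>

definition supporting_weights ::
    "'t::finite security_game \<Rightarrow> ('t \<Rightarrow> real) \<Rightarrow> (real ^ 't) pmf \<Rightarrow> ('t \<Rightarrow> real) \<Rightarrow> bool" where
  "supporting_weights G v C w \<longleftrightarrow>
     (\<forall>t. 0 \<le> w t) \<and> 0 < sum w UNIV \<and>
     (\<forall>t. w t * (best_response_utility G C - target_utility G C t) = 0) \<and>
     (\<forall>C' \<in> defender_strategies G.
        (\<Sum>t\<in>UNIV. w t * v t * marginals G C' $ t) \<le> (\<Sum>t\<in>UNIV. w t * v t * marginals G C $ t))"

section \<open>Utilities as affine functions of the marginals\<close>

lemma target_utility_eq:
  "target_utility G C t = payoff_au G t - attacker_loss G t * marginals G C $ t"
  by (simp add: attacker_utility_return_pmf attacker_loss_def algebra_simps)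

lemma defender_utility_eq:
  "defender_utility G C a =
     (\<Sum>t\<in>UNIV. pmf a t * payoff_du G t)
       + (\<Sum>t\<in>UNIV. pmf a t * defender_gain G t * marginals G C $ t)"
  by (simp add: defender_utility_def defender_gain_def algebra_simps flip: sum.distrib)

lemma attacker_utility_eq:
  "attacker_utility G C a = (\<Sum>t\<in>UNIV. pmf a t * target_utility G C t)"
  unfolding attacker_utility_return_pmf by (simp add: attacker_utility_def)

text \<open>As the first sum does not depend on \<open>C\<close>, minimising the weighted attacker
  utility means maximising the weighted coverage.\<close>

lemma weighted_target_utility:
  "(\<Sum>t\<in>UNIV. w t * target_utility G C t) =
     (\<Sum>t\<in>UNIV. w t * payoff_au G t) - (\<Sum>t\<in>UNIV. w t * attacker_loss G t * marginals G C $ t)"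
  by (simp add: target_utility_eq algebra_simps flip: sum_subtractf)

lemma target_utility_le: "target_utility G C t \<le> best_response_utility G C"
  unfolding best_response_utility_def by (rule Max_ge) auto

lemma best_response_utility_attained:
  obtains t where "target_utility G C t = best_response_utility G C"
proof -
  have "best_response_utility G C \<in> range (target_utility G C)"
    unfolding best_response_utility_def by (rule Max_in) auto
  then show thesis
    using that by auto
qed

lemma weighted_target_utility_le:
  assumes "\<And>t. 0 \<le> w t"
  shows "(\<Sum>t\<in>UNIV. w t * target_utility G C t) \<le> sum w UNIV * best_response_utility G C"
  unfolding sum_distrib_right
  by (intro sum_mono mult_left_mono target_utility_le assms)

text \<open>Every gap to the best response utility is nonnegative, so the weighted gaps vanish one
  by one as soon as their sum does.\<close>

lemma slackness_iff:
  assumes "\<And>t. 0 \<le> w t"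
  shows "(\<forall>t. w t * (best_response_utility G C - target_utility G C t) = 0) \<longleftrightarrow>
         (\<Sum>t\<in>UNIV. w t * target_utility G C t) = sum w UNIV * best_response_utility G C"
proof -
  have "(\<forall>t. w t * (best_response_utility G C - target_utility G C t) = 0) \<longleftrightarrow>
        (\<Sum>t\<in>UNIV. w t * (best_response_utility G C - target_utility G C t)) = 0"
    by (subst sum_nonneg_eq_0_iff) (auto intro!: mult_nonneg_nonneg assms simp: target_utility_le)
  also have "\<dots> \<longleftrightarrow>
      (\<Sum>t\<in>UNIV. w t * target_utility G C t) = sum w UNIV * best_response_utility G C"
    by (auto simp: right_diff_distrib sum_subtractf sum_distrib_right)
  finally show ?thesis .
qed

text \<open>A mixed attack earns an average of the target utilities, which cannot exceed their
  maximum, and attacking a best target attains it.\<close>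

lemma attacker_best_response_iff:
  "(\<forall>a'. attacker_utility G C a' \<le> attacker_utility G C a) \<longleftrightarrow>
     attacker_utility G C a = best_response_utility G C"
proof -
  have "attacker_utility G C a' \<le> best_response_utility G C" for a'
    using weighted_target_utility_le [of "pmf a'" G C]
    by (simp add: attacker_utility_eq [of G C a'] sum_pmf_eq_1)
  moreover obtain t where "target_utility G C t = best_response_utility G C"
    by (rule best_response_utility_attained)
  ultimately show ?thesis
    by (metis order.antisym)
qed

section \<open>Weights and Nash equilibria\<close>

lemma pmf_of_weights:
  fixes w :: "'t::finite \<Rightarrow> real"
  assumes "\<And>t. 0 \<le> w t" "0 < sum w UNIV"
  obtains a where "\<And>t. pmf a t = w t / sum w UNIV"
proof -
  have "(\<integral>\<^sup>+t. ennreal (w t / sum w UNIV) \<partial>count_space UNIV) = ennreal (\<Sum>t\<in>UNIV. w t / sum w UNIV)"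
    using assms by (simp add: nn_integral_count_space_finite sum_nonneg)
  also have "(\<Sum>t\<in>UNIV. w t / sum w UNIV) = 1"
    using assms by (simp flip: sum_divide_distrib)
  finally have "pmf (embed_pmf (\<lambda>t. w t / sum w UNIV)) t = w t / sum w UNIV" for t
    using assms by (intro pmf_embed_pmf) (auto simp: sum_nonneg)
  then show thesis
    by (rule that)
qed

text \<open>The defender's utility is a term independent of \<open>C\<close> plus the weighted
  coverage, so the defender's equilibrium condition is the maximality condition on the marginals;
  the attacker's is slackness.\<close>

lemma nash_equilibrium_iff:
  "nash_equilibrium G C a \<longleftrightarrow>
     C \<in> defender_strategies G \<and> supporting_weights G (defender_gain G) C (pmf a)"
  unfolding nash_equilibrium_def supporting_weights_def attacker_best_response_iff
    slackness_iff [of "pmf a", OF pmf_nonneg] attacker_utility_eq [of G C a, symmetric]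
  by (auto simp: sum_pmf_eq_1 defender_utility_eq)

lemma supporting_weights_scale:
  assumes "supporting_weights G v C w" "0 < k"
  shows "supporting_weights G v C (\<lambda>t. w t / k)"
  using assms
  by (simp add: supporting_weights_def divide_right_mono flip: sum_divide_distrib)

text \<open>The new weights times \<open>v'\<close> equal the old ones times \<open>v\<close>, so
  the same linear functional is maximised, and zero weights stay zero, which preserves
  slackness.\<close>

lemma supporting_weights_change:
  assumes w: "supporting_weights G v C w" and v: "\<And>t. 0 < v t" and v': "\<And>t. 0 < v' t"
  shows "supporting_weights G v' C (\<lambda>t. w t * v t / v' t)"
proof -
  have nonneg: "0 \<le> w t * v t / v' t" for t
    using w v [of t] v' [of t] by (simp add: supporting_weights_def)
  obtain t where "w t \<noteq> 0"
    using w unfolding supporting_weights_def by (metis less_irrefl sum.neutral)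
  then have "0 < (\<Sum>t\<in>UNIV. w t * v t / v' t)"
    using nonneg v [of t] v' [of t] by (intro sum_pos2 [where i = t]) (auto simp: less_le)
  moreover have "w t * v t / v' t * v' t = w t * v t" for t
    using v' [of t] by simp
  ultimately show ?thesis
    using w nonneg by (auto simp: supporting_weights_def)
qed

lemma NE_strategies_iff:
  "C \<in> NE_strategies G \<longleftrightarrow>
     C \<in> defender_strategies G \<and> (\<exists>w. supporting_weights G (defender_gain G) C w)"
proof
  assume "C \<in> NE_strategies G"
  then show "C \<in> defender_strategies G \<and> (\<exists>w. supporting_weights G (defender_gain G) C w)"
    by (auto simp: NE_strategies_def nash_equilibrium_iff)
next
  assume "C \<in> defender_strategies G \<and> (\<exists>w. supporting_weights G (defender_gain G) C w)"
  then obtain w where C: "C \<in> defender_strategies G"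
      and w: "supporting_weights G (defender_gain G) C w"
    by blast
  obtain a where "\<And>t. pmf a t = w t / sum w UNIV"
    using pmf_of_weights [of w] w unfolding supporting_weights_def by blast
  then have "pmf a = (\<lambda>t. w t / sum w UNIV)"
    by blast
  moreover have "0 < sum w UNIV"
    using w by (simp add: supporting_weights_def)
  ultimately have "supporting_weights G (defender_gain G) C (pmf a)"
    using supporting_weights_scale [OF w] by simp
  then show "C \<in> NE_strategies G"
    using C by (auto simp: NE_strategies_def nash_equilibrium_iff)
qed

section \<open>Minimax strategies and the minimax theorem\<close>

lemma minimax_strategies_iff:
  assumes "security_game G"
  shows "C \<in> minimax_strategies G \<longleftrightarrow>
           C \<in> defender_strategies G \<and>
           (\<forall>C' \<in> defender_strategies G. best_response_utility G C \<le> best_response_utility G C')"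
proof -
  obtain C0 where C0: "C0 \<in> defender_strategies G"
      "\<forall>C' \<in> defender_strategies G. best_response_utility G C0 \<le> best_response_utility G C'"
    using min_best_response_utility_attained [OF assms] by blast
  \<comment> \<open>The \<open>LEAST\<close> denotes a minimum because one is attained, here at
    \<open>C0\<close>.\<close>
  have "min_best_response_utility G = best_response_utility G C0"
    unfolding min_best_response_utility_def by (rule Least_equality) (use C0 in auto)
  then show ?thesis
    using C0 by (force simp: minimax_strategies_def)
qed

text \<open>Target utilities depend affinely on the marginals, and the marginals fill a convex
  hull.\<close>

lemma convex_target_utilities:
  "convex ((\<lambda>C. \<chi> t. target_utility G C t) ` defender_strategies G)"
proof -
  have "(\<lambda>C. \<chi> t. target_utility G C t) ` defender_strategies G =
        (\<lambda>x. (\<chi> t. payoff_au G t) + x) `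
          (\<lambda>x. \<chi> t. - attacker_loss G t * x $ t) ` marginals G ` defender_strategies G"
    by (auto simp: image_image target_utility_eq plus_vec_def)
  moreover have "linear (\<lambda>x::real ^ 'a. \<chi> t. - attacker_loss G t * x $ t)"
    by (rule linearI) (simp_all add: vec_eq_iff algebra_simps)
  ultimately show ?thesis
    by (simp only: marginals_image convex_translation convex_linear_image convex_convex_hull)
qed

text \<open>The minimax theorem: the utility vectors available to the defender are separated from the
  vectors all of whose entries lie below the value.\<close>

lemma optimal_attacker_weights:
  assumes "C \<in> defender_strategies G"
    and min: "\<forall>C' \<in> defender_strategies G. e \<le> best_response_utility G C'"
  obtains w where "\<And>t. 0 \<le> w t" "0 < sum w UNIV"
    "\<And>C'. C' \<in> defender_strategies G \<Longrightarrow>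
       sum w UNIV * e \<le> (\<Sum>t\<in>UNIV. w t * target_utility G C' t)"
proof -
  define K where "K = (\<lambda>C. \<chi> t. target_utility G C t) ` defender_strategies G"
  define P where "P = {y::real ^ 'a. \<forall>t. y $ t < e}"
  have "convex P"
    by (auto simp: P_def convex_def intro!: convex_bound_lt)
  moreover have "(\<chi> t. e - 1) \<in> P"
    by (simp add: P_def)
  then have "P \<noteq> {}"
    by blast
  moreover have "P \<inter> K = {}"
  proof -
    have "(\<chi> t. target_utility G C' t) \<notin> P" if "C' \<in> defender_strategies G" for C'
    proof -
      obtain t where "target_utility G C' t = best_response_utility G C'"
        by (rule best_response_utility_attained)
      then have "\<not> target_utility G C' t < e"
        using min that by force
      then show ?thesis
        by (auto simp: P_def)
    qed
    then show ?thesis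
      by (auto simp: K_def)
  qed
  moreover have "convex K" "K \<noteq> {}"
    using convex_target_utilities assms(1) by (auto simp: K_def)
  ultimately obtain a b where "a \<noteq> 0" and P: "\<forall>x\<in>P. inner a x \<le> b" and K: "\<forall>x\<in>K. b \<le> inner a x"
    using separating_hyperplane_sets [of P K] by blast
  define w where "w = (\<lambda>t. a $ t)"
  \<comment> \<open>The hyperplane is tested at a constant vector just below \<open>e\<close>,
    lowered further by \<open>s\<close> in coordinate \<open>t\<close>. Large \<open>s\<close> will
    force nonnegative weights; \<open>s = 0\<close> with small \<open>\<epsilon>\<close> will bound
    the value.\<close>
  have low: "w t * (- s) + sum w UNIV * (e - \<epsilon>) \<le> b" if "0 \<le> s" "0 < \<epsilon>" for t s \<epsilon>
  proof -
    have "(\<chi> t'. e - \<epsilon>) - s *\<^sub>R axis t 1 \<in> P"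
      using that by (auto simp: P_def axis_def)
    with P have "inner a ((\<chi> t'. e - \<epsilon>) - s *\<^sub>R axis t 1) \<le> b"
      by blast
    moreover have "inner a (\<chi> t'. e - \<epsilon>) = sum w UNIV * (e - \<epsilon>)"
      by (simp add: inner_vec_def w_def sum_distrib_right)
    ultimately show ?thesis
      by (simp add: inner_diff_right inner_axis w_def algebra_simps)
  qed
  have nonneg: "0 \<le> w t" for t
  proof (rule ccontr)
    assume neg: "\<not> 0 \<le> w t"
    \<comment> \<open>Lowering coordinate \<open>t\<close> by \<open>r / - w t\<close> would raise
      the inner product by \<open>r\<close>, which is chosen just large enough to exceed
      \<open>b\<close>.\<close>
    define r where "r = \<bar>b - sum w UNIV * (e - 1)\<bar> + 1"
    have "w t * (- (r / - w t)) = r"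
      using neg by simp
    with low [of "r / - w t" 1 t] neg show False
      by (simp add: r_def divide_nonneg_neg)
  qed
  obtain t where "w t \<noteq> 0"
    using \<open>a \<noteq> 0\<close> by (auto simp: w_def vec_eq_iff)
  then have pos: "0 < sum w UNIV"
    using nonneg by (intro sum_pos2 [where i = t]) (auto simp: less_le)
  have "sum w UNIV * e \<le> b"
  proof (rule field_le_epsilon)
    fix \<delta> :: real assume "0 < \<delta>"
    then have "sum w UNIV * (e - \<delta> / sum w UNIV) \<le> b"
      using low [of 0 "\<delta> / sum w UNIV"] pos by simp
    then show "sum w UNIV * e \<le> b + \<delta>"
      using pos by (simp add: right_diff_distrib)
  qed
  moreover have "b \<le> (\<Sum>t\<in>UNIV. w t * target_utility G C' t)"
    if "C' \<in> defender_strategies G" for C'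
    using K that by (auto simp: K_def w_def inner_vec_def)
  ultimately show thesis
    using that nonneg pos by (meson order_trans)
qed

lemma minimax_strategies_iff_weights:
  assumes "security_game G"
  shows "C \<in> minimax_strategies G \<longleftrightarrow>
           C \<in> defender_strategies G \<and> (\<exists>w. supporting_weights G (attacker_loss G) C w)"
proof
  assume "C \<in> minimax_strategies G"
  then have C: "C \<in> defender_strategies G"
      "\<forall>C' \<in> defender_strategies G. best_response_utility G C \<le> best_response_utility G C'"
    by (simp_all add: minimax_strategies_iff [OF assms])
  then obtain w where w: "\<And>t. 0 \<le> w t" "0 < sum w UNIV"
      "\<And>C'. C' \<in> defender_strategies G \<Longrightarrow>
         sum w UNIV * best_response_utility G C \<le> (\<Sum>t\<in>UNIV. w t * target_utility G C' t)"
    using optimal_attacker_weights by blast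
  \<comment> \<open>The weights guarantee at least the value against every strategy, while against
    \<open>C\<close> no average exceeds it.\<close>
  have eq: "(\<Sum>t\<in>UNIV. w t * target_utility G C t) = sum w UNIV * best_response_utility G C"
    using w(3) [OF C(1)] weighted_target_utility_le [of w G C, OF w(1)] by simp
  \<comment> \<open>By \<open>eq\<close>, the guarantee says that \<open>C\<close> minimises the
    weighted attacker utility.\<close>
  have "(\<Sum>t\<in>UNIV. w t * attacker_loss G t * marginals G C' $ t)
      \<le> (\<Sum>t\<in>UNIV. w t * attacker_loss G t * marginals G C $ t)"
    if "C' \<in> defender_strategies G" for C'
    using w(3) [OF that] unfolding eq [symmetric] weighted_target_utility by simp
  then have "supporting_weights G (attacker_loss G) C w"
    unfolding supporting_weights_def slackness_iff [of w, OF w(1)] using w(1,2) eq by simp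
  with C show "C \<in> defender_strategies G \<and> (\<exists>w. supporting_weights G (attacker_loss G) C w)"
    by blast
next
  assume "C \<in> defender_strategies G \<and> (\<exists>w. supporting_weights G (attacker_loss G) C w)"
  then obtain w where C: "C \<in> defender_strategies G"
      and sw: "supporting_weights G (attacker_loss G) C w"
    by blast
  then have w: "\<And>t. 0 \<le> w t" "0 < sum w UNIV"
    by (auto simp: supporting_weights_def)
  have "best_response_utility G C \<le> best_response_utility G C'"
    if "C' \<in> defender_strategies G" for C'
  proof -
    \<comment> \<open>Weak duality: slackness at \<open>C\<close>, then maximality of its coverage,
      then the bound of an average by the maximum at \<open>C'\<close>.\<close>
    have "sum w UNIV * best_response_utility G C = (\<Sum>t\<in>UNIV. w t * target_utility G C t)"
      using sw slackness_iff [of w G C] w(1) by (simp add: supporting_weights_def)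
    also have "\<dots> \<le> (\<Sum>t\<in>UNIV. w t * target_utility G C' t)"
      using sw that unfolding weighted_target_utility by (simp add: supporting_weights_def)
    also have "\<dots> \<le> sum w UNIV * best_response_utility G C'"
      using w(1) by (rule weighted_target_utility_le)
    finally show ?thesis
      using w(2) by simp
  qed
  with C show "C \<in> minimax_strategies G"
    by (simp add: minimax_strategies_iff [OF assms])
qed

theorem theorem3p4:
  fixes G :: "'t::finite security_game"
  assumes "security_game G"
  shows "minimax_strategies G = NE_strategies G"
proof -
  have "0 < defender_gain G t" "0 < attacker_loss G t" for t
    using assms by (simp_all add: security_game_def defender_gain_def attacker_loss_def)
  then have "(\<exists>w. supporting_weights G (attacker_loss G) C w) \<longleftrightarrow>
             (\<exists>w. supporting_weights G (defender_gain G) C w)" for C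
    using supporting_weights_change by blast
  then show ?thesis
    by (auto simp: minimax_strategies_iff_weights [OF assms] NE_strategies_iff)
qed

end
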